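(* There exists a simple $5$-$(16,7,10)$ design.
   Context: A $t$-$(v,k,\lambda)$ design consists of a $v$-element set $P$ of points together with a collection $B$ of $k$-element subsets of $P$ (called blocks) such that every $t$-element subset of $P$ is contained in exactly $\lambda$ blocks. The design is simple if $B$ is a set, i.e. contains no repeated blocks. *)

theory Defs
  imports Main "HOL-Library.Multiset"
begin

text \<open>The blocks form a multiset, so that a design may have repeated blocks.\<close>

definition is_design :: "nat \<Rightarrow> nat \<Rightarrow> nat \<Rightarrow> nat \<Rightarrow> 'a set \<Rightarrow> 'a set multiset \<Rightarrow> bool" where
  "is_design t v k l P B \<longleftrightarrow>
     finite P \<and> card P = v \<and>
     (\<forall>b \<in># B. b \<subseteq> P \<and> card b = k) \<and>
     (\<forall>T. T \<subseteq> P \<and> card T = t \<longrightarrow> size {# b \<in># B. T \<subseteq> b #} = l)"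

definition simple_blocks :: "'a set multiset \<Rightarrow> bool" where
  "simple_blocks B \<longleftrightarrow> (\<forall>b \<in># B. count B b = 1)"

end

theory Submission
  imports Defs
begin

text \<open>
  The blocks are the images of 13 base blocks under a group of 192 affine permutations of
  \<open>GF(2)\<^sup>4\<close>, found by solving the linear system (one equation per orbit of 5-subsets, one 0/1 unknown
  per orbit of 7-subsets) that prescribing this automorphism group leads to.

  To verify the design, the blocks are stored in a binary trie, branching on one point after the
  other. To count the blocks containing a set \<open>T\<close>, a point in \<open>T\<close> selects one branch, and a point
  outside \<open>T\<close> adds up both branches; doing this for all 5-subsets simultaneously shares most of
  the work.
\<close>

text \<open>
  In a trie over the points below \<open>n\<close>, the root decides about the point \<open>n - 1\<close>, and the right
  branch contains the blocks through it. \<open>Leaf m\<close> stands for \<open>m\<close> copies of the set of all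
  remaining points, so that \<open>Leaf 0\<close> is the empty collection at every depth.
\<close>

datatype trie = Leaf nat | Node trie trie

fun insert_block :: "bool list \<Rightarrow> trie \<Rightarrow> trie" where
  "insert_block [] s = Leaf 1"
| "insert_block (False # xs) (Leaf m) = Node (insert_block xs (Leaf m)) (Leaf m)"
| "insert_block (True # xs) (Leaf m) = Node (Leaf m) (insert_block xs (Leaf m))"
| "insert_block (False # xs) (Node l r) = Node (insert_block xs l) r"
| "insert_block (True # xs) (Node l r) = Node l (insert_block xs r)"

fun merge :: "trie \<Rightarrow> trie \<Rightarrow> trie" where
  "merge (Leaf 0) s = s"
| "merge (Leaf (Suc m)) (Leaf m') = Leaf (Suc m + m')"
| "merge (Leaf (Suc m)) (Node l r) = Node l (merge (Leaf (Suc m)) r)"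
| "merge (Node l r) (Leaf 0) = Node l r"
| "merge (Node l r) (Leaf (Suc m)) = Node l (merge (Leaf (Suc m)) r)"
| "merge (Node l r) (Node l' r') = Node (merge l l') (merge r r')"

primrec weight :: "trie \<Rightarrow> nat" where
  "weight (Leaf m) = m"
| "weight (Node l r) = weight l + weight r"

text \<open>\<open>n < t\<close> means that there are no \<open>Suc t\<close>-subsets of \<open>Suc n\<close> points left to check.\<close>

fun balanced :: "nat \<Rightarrow> nat \<Rightarrow> nat \<Rightarrow> trie \<Rightarrow> bool" where
  "balanced l n 0 s = (weight s = l)"
| "balanced l 0 (Suc t) s = True"
| "balanced l (Suc n) (Suc t) (Leaf m) = (n < t \<or> m = l)"
| "balanced l (Suc n) (Suc t) (Node p q) =
     (n < t \<or> balanced l n (Suc t) (merge p q) \<and> balanced l n t q)"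

fun uniform :: "nat \<Rightarrow> nat \<Rightarrow> trie \<Rightarrow> bool" where
  "uniform 0 k (Leaf m) = (m = 0 \<or> m = 1 \<and> k = 0)"
| "uniform (Suc n) k (Leaf m) = (m = 0)"
| "uniform 0 k (Node l r) = False"
| "uniform (Suc n) 0 (Node l r) = (uniform n 0 l \<and> r = Leaf 0)"
| "uniform (Suc n) (Suc k) (Node l r) = (uniform n (Suc k) l \<and> uniform n k r)"

primrec spread :: "('a \<Rightarrow> 'a) \<Rightarrow> nat \<Rightarrow> 'a list \<Rightarrow> 'a list" where
  "spread f 0 xs = []"
| "spread f (Suc k) xs = xs @ spread f k (map f xs)"

definition permute :: "nat list \<Rightarrow> bool list \<Rightarrow> bool list" where
  "permute p b = map (\<lambda>i. b ! i) p"

text \<open>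
  As the root of a trie decides about the largest point, the numbers \<open>i\<close> below end up as the points
  \<open>15 - i\<close> of the design.
\<close>

definition indicator_list :: "nat list \<Rightarrow> bool list" where
  "indicator_list b = map (\<lambda>i. i \<in> set b) [0..<16]"

definition base_blocks :: "nat list list" where
  "base_blocks =
    [[0,1,3,4,5,6,8], [1,2,3,4,5,6,8], [0,1,2,3,4,7,8], [0,1,3,5,6,7,8], [1,2,3,5,6,7,8],
     [0,2,4,5,6,7,8], [0,2,4,5,6,8,9], [0,1,2,3,7,8,9], [0,1,3,5,7,8,9], [0,2,3,4,5,9,10],
     [1,2,3,4,6,9,10], [1,2,4,5,6,9,10], [0,1,2,3,4,8,12]]"

text \<open>
  The group is the product of the cyclic groups generated by the four permutations, which have
  orders 6, 4, 2 and 4. Four of the base blocks have nontrivial stabilisers, so 416 of the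
  2496 entries are repetitions; the trie absorbs them.
\<close>

definition orbit_blocks :: "bool list list" where
  "orbit_blocks =
    (spread (permute [6,15,12,5,2,11,8,1,14,7,4,13,10,3,0,9]) 4 \<circ>
     spread (permute [5,7,4,6,2,0,3,1,13,15,12,14,10,8,11,9]) 2 \<circ>
     spread (permute [2,0,3,1,6,4,7,5,10,8,11,9,14,12,15,13]) 4 \<circ>
     spread (permute [11,7,15,3,6,10,2,14,0,12,4,8,13,1,9,5]) 6)
       (map indicator_list base_blocks)"

definition design_trie :: trie where
  "design_trie = fold insert_block orbit_blocks (Leaf 0)"

fun blocks :: "trie \<Rightarrow> nat \<Rightarrow> nat set set" where
  "blocks (Leaf m) n = (if m = 0 then {} else {{..<n}})"
| "blocks (Node l r) 0 = {}"
| "blocks (Node l r) (Suc n) = blocks l n \<union> insert n ` blocks r n"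

text \<open>The value at depth 0 lets \<open>hits_merge\<close> and \<open>hits_disjoint\<close>
  hold for malformed tries too.\<close>

fun hits :: "trie \<Rightarrow> nat \<Rightarrow> nat set \<Rightarrow> nat" where
  "hits (Leaf m) n T = m"
| "hits (Node l r) 0 T = hits l 0 T + hits r 0 T"
| "hits (Node l r) (Suc n) T = (if n \<in> T then 0 else hits l n T) + hits r n T"

lemma finite_blocks: "finite (blocks s n)"
  by (induction s n rule: blocks.induct) auto

lemma uniform_blocks:
  assumes "uniform n k s" and "b \<in> blocks s n"
  shows "b \<subseteq> {..<n} \<and> card b = k"
  using assms
proof (induction n k s arbitrary: b rule: uniform.induct)
  case (1 k m)
  then show ?case by (auto split: if_splits)
next
  case (4 n l r)
  then have "b \<subseteq> {..<n} \<and> card b = 0" by auto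
  then show ?case by auto
next
  case (5 n k l r)
  show ?case
  proof (cases "b \<in> blocks l n")
    case True
    with 5 have "b \<subseteq> {..<n} \<and> card b = Suc k" by auto
    then show ?thesis by auto
  next
    case False
    with 5(4) obtain c where c: "c \<in> blocks r n" "b = insert n c" by auto
    with 5 have "c \<subseteq> {..<n}" "card c = k" by auto
    moreover from this have "finite c" "n \<notin> c" by (auto intro: finite_subset)
    ultimately show ?thesis using c by auto
  qed
qed simp_all

lemma hits_merge: "hits (merge p q) n T = hits p n T + hits q n T"
proof (induction p q arbitrary: n rule: merge.induct)
  case (3 m l r) then show ?case by (cases n) auto
next
  case (5 l r m) then show ?case by (cases n) auto
next
  case (6 l r l' r') then show ?case by (cases n) auto
qed simp_all

lemma hits_disjoint: "T \<inter> {..<n} = {} \<Longrightarrow> hits s n T = weight s"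
proof (induction s arbitrary: n)
  case (Node l r)
  then show ?case by (cases n) (auto simp: lessThan_Suc)
qed simp

lemma balanced_hits:
  assumes "balanced l n t s" and "card (T \<inter> {..<n}) = t"
  shows "hits s n T = l"
  using assms
proof (induction l n t s rule: balanced.induct)
  case (1 l n s)
  then show ?case by (simp add: hits_disjoint)
next
  case (3 l n t m)
  \<comment> \<open>With \<open>Suc t\<close> points of \<open>T\<close> below \<open>Suc n\<close>,
    this bound excludes the alternative \<open>n < t\<close>.\<close>
  have "card (T \<inter> {..<Suc n}) \<le> Suc n"
    using card_mono[of "{..<Suc n}" "T \<inter> {..<Suc n}"] by simp
  with 3 show ?case by auto
next
  case (4 l n t p q)
  have "card (T \<inter> {..<Suc n}) \<le> Suc n"
    using card_mono[of "{..<Suc n}" "T \<inter> {..<Suc n}"] by simp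
  with 4(3,4) have bal: "balanced l n (Suc t) (merge p q)" "balanced l n t q"
    by auto
  have card: "card (T \<inter> {..<Suc n}) = (if n \<in> T then 1 else 0) + card (T \<inter> {..<n})"
    by (simp add: lessThan_Suc Int_insert_right)
  show ?case
  proof (cases "n \<in> T")
    case True
    then show ?thesis
      using 4(2)[OF bal(2)] 4(4) card by simp
  next
    case False
    then show ?thesis
      using 4(1)[OF bal(1)] 4(4) card by (simp add: hits_merge)
  qed
qed simp

text \<open>\<open>uniform\<close> admits only leaves 0 and 1, and 1 only at depth 0, so counting
  with multiplicity agrees with counting in the set \<open>blocks s n\<close>.\<close>

lemma hits_eq_card:
  assumes "uniform n k s"
  shows "hits s n T = card {b \<in> blocks s n. T \<inter> {..<n} \<subseteq> b}"
  using assms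
proof (induction n k s rule: uniform.induct)
  case (1 k m)
  have "{b. b = {} \<and> T \<inter> {} \<subseteq> b} = {{}}" by auto
  with 1 show ?case by auto
next
  case (4 n l r)
  then have "n \<notin> b" if "b \<in> blocks l n" for b
    using uniform_blocks[of n 0 l b] that by auto
  then have "{b \<in> blocks l n. T \<inter> {..<Suc n} \<subseteq> b} =
      (if n \<in> T then {} else {b \<in> blocks l n. T \<inter> {..<n} \<subseteq> b})"
    by (auto simp: lessThan_Suc)
  with 4 show ?case by auto
next
  case (5 n k l r)
  let ?L = "{b \<in> blocks l n. T \<inter> {..<Suc n} \<subseteq> b}"
  let ?R = "{b \<in> blocks r n. T \<inter> {..<n} \<subseteq> b}"
  have l: "n \<notin> b" if "b \<in> blocks l n" for b
    using uniform_blocks[of n "Suc k" l b] that 5 by auto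
  have r: "n \<notin> b" if "b \<in> blocks r n" for b
    using uniform_blocks[of n k r b] that 5 by auto
  have "?L = (if n \<in> T then {} else {b \<in> blocks l n. T \<inter> {..<n} \<subseteq> b})"
    using l by (auto simp: lessThan_Suc)
  then have "card ?L = (if n \<in> T then 0 else hits l n T)"
    using 5 by simp
  moreover have "inj_on (insert n) ?R"
    using r by (intro inj_onI) (metis (no_types, lifting) insert_ident mem_Collect_eq)
  then have "card (insert n ` ?R) = hits r n T"
    using 5 by (simp add: card_image)
  moreover have "{b \<in> blocks (Node l r) (Suc n). T \<inter> {..<Suc n} \<subseteq> b} = ?L \<union> insert n ` ?R"
    using r by (auto simp: lessThan_Suc)
  moreover have "?L \<inter> insert n ` ?R = {}"
    using l by auto
  ultimately show ?case
    by (simp add: card_Un_disjoint finite_blocks)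
qed auto

lemma is_design_blocks:
  assumes "uniform v k s" and "balanced l v t s"
  shows "is_design t v k l {..<v} (mset_set (blocks s v))"
  unfolding is_design_def
proof (intro conjI ballI allI impI)
  fix T :: "nat set"
  assume T: "T \<subseteq> {..<v} \<and> card T = t"
  then have "hits s v T = l"
    using balanced_hits[OF assms(2)] by (simp add: Int_absorb2)
  then show "size {# b \<in># mset_set (blocks s v). T \<subseteq> b #} = l"
    using T hits_eq_card[OF assms(1), of T] by (simp add: finite_blocks Int_absorb2)
qed (use uniform_blocks[OF assms(1)] in \<open>auto simp: finite_blocks\<close>)

lemma design_trie_checked: "uniform 16 7 design_trie \<and> balanced 10 16 5 design_trie"
  by code_simp

theorem theorem8:
  shows "\<exists>(P :: nat set) (B :: nat set multiset). is_design 5 16 7 10 P B \<and> simple_blocks B"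
proof (intro exI conjI)
  show "is_design 5 16 7 10 {..<16} (mset_set (blocks design_trie 16))"
    using is_design_blocks design_trie_checked by blast
  show "simple_blocks (mset_set (blocks design_trie 16))"
    by (simp add: simple_blocks_def finite_blocks)
qed

end
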